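(* Let $\mu\in M_{\mathrm{loc}}(\mathbf{R}^d\setminus\{0\})$ be homogeneous of non-integral degree $\alpha<-d$, and assume $\mu(H_{\omega,p})=0$ for almost all halfspaces $H_{\omega,p}$ with $\overline{H_{\omega,p}}\subset\mathbf{R}^d\setminus\{0\}$. Then $\mu=0$. *)

theory Defs
  imports "HOL-Analysis.Analysis"
begin

text \<open>A real (signed) locally finite Borel measure on R^d minus the origin is represented by its
  Jordan decomposition: two mutually singular nonnegative Borel measures on R^d, both giving
  zero mass to the origin and finite mass to every compact set not containing the origin.\<close>

definition loc_finite_away0 :: "'a::euclidean_space measure \<Rightarrow> bool" where
  "loc_finite_away0 M \<longleftrightarrow> sets M = sets borel \<and> emeasure M {0} = 0 \<and>
     (\<forall>K. compact K \<and> 0 \<notin> K \<longrightarrow> emeasure M K < \<infinity>)"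

definition mutually_singular :: "'a measure \<Rightarrow> 'a measure \<Rightarrow> bool" where
  "mutually_singular M N \<longleftrightarrow> (\<exists>S\<in>sets M. emeasure M S = 0 \<and> emeasure N (space N - S) = 0)"

text \<open>Value of the signed measure mu = M - N on a set (meaningful when both parts are finite).\<close>
definition signed_val :: "'a measure \<Rightarrow> 'a measure \<Rightarrow> 'a set \<Rightarrow> real" where
  "signed_val M N A = measure M A - measure N A"

text \<open>Homogeneity of degree alpha (distributional convention): mu(tA) = t^(alpha+d) mu(A)
  for all t > 0 and all Borel sets A relatively compact in R^d minus the origin.\<close>
definition homogeneous_signed :: "'a::euclidean_space measure \<Rightarrow> 'a measure \<Rightarrow> real \<Rightarrow> bool" where
  "homogeneous_signed M N \<alpha> \<longleftrightarrow>
     (\<forall>t>0. \<forall>A\<in>sets borel. bounded A \<and> 0 \<notin> closure A \<longrightarrow>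
        signed_val M N ((*\<^sub>R) t ` A) = t powr (\<alpha> + real DIM('a)) * signed_val M N A)"

text \<open>Open halfspace {x. xi . x > p}; for xi of unit length this is H_{xi,p}.\<close>
definition halfspace :: "'a::euclidean_space \<Rightarrow> real \<Rightarrow> 'a set" where
  "halfspace \<xi> p = {x. \<xi> \<bullet> x > p}"

end

theory Submission
  imports Defs "HOL-Probability.Characteristic_Functions"
begin

text \<open>Put \<open>\<beta> = - (\<alpha> + d) > 0\<close> and \<open>m < \<beta> < m + 1\<close>. Homogeneity makes \<open>min (|x|^m) (|x|^(m+1))\<close>
  integrable for both parts of \<open>\<mu>\<close>. Equality on halfspaces says that the images of both parts under
  \<open>x \<mapsto> \<xi> \<bullet> x\<close> agree away from 0, so \<open>\<mu>\<close> annihilates \<open>x \<mapsto> G (\<xi> \<bullet> x)\<close>, where \<open>G t\<close> is \<open>e^(it)\<close> minus its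
  Taylor polynomial of degree \<open>m\<close>; this is where \<open>\<beta>\<close> must not be an integer. Taking \<open>m + 1\<close> central
  differences in \<open>\<xi>\<close> with step \<open>h\<close> kills the polynomial and leaves the Fourier transform of the
  finite measure \<open>(1 - cos (h \<bullet> x))^(m+1) \<mu>\<close>, which therefore vanishes for every \<open>h\<close>.\<close>

subsection \<open>Uniqueness of the Fourier transform\<close>

text \<open>The phase \<open>c\<close> lets one generator cover cosines, sines and, at frequency 0,
  constants. Frequencies are arbitrary vectors, so the Fourier transform of a finite measure
  determines the integrals of all these functions.\<close>

inductive trig_polynomial :: "('a::real_inner \<Rightarrow> real) \<Rightarrow> bool" where
  cos: "trig_polynomial (\<lambda>x. a * cos (\<xi> \<bullet> x + c))"
| add: "trig_polynomial f \<Longrightarrow> trig_polynomial g \<Longrightarrow> trig_polynomial (\<lambda>x. f x + g x)"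

lemma trig_polynomial_const: "trig_polynomial (\<lambda>x. a)"
  using trig_polynomial.cos[of a 0 0] by simp

text \<open>The product-to-sum formula handles two generators. This makes the class an algebra, as
  Stone--Weierstrass requires.\<close>

lemma trig_polynomial_mult:
  assumes "trig_polynomial f" and "trig_polynomial g"
  shows "trig_polynomial (\<lambda>x. f x * g x)"
  using assms
proof (induction f rule: trig_polynomial.induct)
  case (cos a \<xi> c)
  from cos show ?case
  proof (induction g rule: trig_polynomial.induct)
    case (cos b \<eta> d)
    have "(\<lambda>x. a * cos (\<xi> \<bullet> x + c) * (b * cos (\<eta> \<bullet> x + d))) =
      (\<lambda>x. a * b / 2 * cos ((\<xi> - \<eta>) \<bullet> x + (c - d)) + a * b / 2 * cos ((\<xi> + \<eta>) \<bullet> x + (c + d)))"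
    proof
      fix x
      have "cos (\<xi> \<bullet> x + c) * cos (\<eta> \<bullet> x + d) =
        (cos ((\<xi> - \<eta>) \<bullet> x + (c - d)) + cos ((\<xi> + \<eta>) \<bullet> x + (c + d))) / 2"
        unfolding cos_times_cos by (simp add: algebra_simps)
      then have "a * b * (cos (\<xi> \<bullet> x + c) * cos (\<eta> \<bullet> x + d)) =
        a * b * ((cos ((\<xi> - \<eta>) \<bullet> x + (c - d)) + cos ((\<xi> + \<eta>) \<bullet> x + (c + d))) / 2)"
        by (rule arg_cong)
      then show "a * cos (\<xi> \<bullet> x + c) * (b * cos (\<eta> \<bullet> x + d)) =
        a * b / 2 * cos ((\<xi> - \<eta>) \<bullet> x + (c - d)) + a * b / 2 * cos ((\<xi> + \<eta>) \<bullet> x + (c + d))"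
        by (simp add: distrib_left mult_ac add_divide_distrib)
    qed
    then show ?case by (simp only: trig_polynomial.intros)
  next
    case (add f g)
    then show ?case by (simp add: distrib_left trig_polynomial.add)
  qed
next
  case (add f g)
  then show ?case by (simp add: distrib_right trig_polynomial.add)
qed

lemma trig_polynomial_bounded:
  assumes "trig_polynomial f"
  obtains B where "\<And>x. \<bar>f x\<bar> \<le> B"
proof -
  have "\<exists>B. \<forall>x. \<bar>f x\<bar> \<le> B"
    using assms
  proof (induction rule: trig_polynomial.induct)
    case (cos a \<xi> c)
    have "\<bar>a * cos (\<xi> \<bullet> x + c)\<bar> \<le> \<bar>a\<bar>" for x
      by (simp add: abs_mult mult_left_le)
    then show ?case by blast
  next
    case (add f g)
    then obtain B C where "\<And>x. \<bar>f x\<bar> \<le> B" "\<And>x. \<bar>g x\<bar> \<le> C" by blast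
    then have "\<bar>f x + g x\<bar> \<le> B + C" for x
      by (meson abs_triangle_ineq add_mono order_trans)
    then show ?case by blast
  qed
  then show thesis using that by blast
qed

lemma trig_polynomial_continuous:
  assumes "trig_polynomial f" shows "continuous_on S f"
  using assms by (induction rule: trig_polynomial.induct) (auto intro!: continuous_intros)

lemma trig_polynomial_separates:
  fixes x y :: "'a::real_inner"
  assumes "x \<noteq> y"
  obtains f where "trig_polynomial f" and "f x \<noteq> f y"
proof -
  define s where "s = (norm (x - y))\<^sup>2"
  have "s > 0" using assms by (simp add: s_def)
  \<comment> \<open>The scaling gives \<open>\<xi> \<bullet> (x - y) = pi / 2\<close>; with the
    phase normalised at \<open>y\<close>, the cosine is 1 at \<open>y\<close> and 0 at
    \<open>x\<close>.\<close>
  define \<xi> where "\<xi> = (pi / (2 * s)) *\<^sub>R (x - y)"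
  have "cos (\<xi> \<bullet> (x - y)) = 0"
    using \<open>s > 0\<close> by (simp add: \<xi>_def s_def power2_norm_eq_inner)
  then have "cos (\<xi> \<bullet> x + - (\<xi> \<bullet> y)) \<noteq> cos (\<xi> \<bullet> y + - (\<xi> \<bullet> y))"
    by (simp add: inner_diff_right)
  then show thesis
    using that[of "\<lambda>z. 1 * cos (\<xi> \<bullet> z + - (\<xi> \<bullet> y))"] trig_polynomial.cos[of 1 \<xi> "- (\<xi> \<bullet> y)"]
    by simp
qed

lemma trig_polynomial_compose:
  assumes "real_polynomial_function q" and "trig_polynomial p"
  shows "trig_polynomial (\<lambda>x. q (p x))"
  using assms(1)
proof (induction rule: real_polynomial_function.induct)
  case (linear f)
  then obtain c where "f = (\<lambda>x. x * c)"
    using real_bounded_linear by blast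
  then show ?case
    using trig_polynomial_mult[OF assms(2) trig_polynomial_const] by simp
qed (auto intro: trig_polynomial_const trig_polynomial.add trig_polynomial_mult)

text \<open>Stone--Weierstrass on the ball gives no control outside it; composing with a polynomial
  approximation of the clipping map on the range of the approximant restores a global bound.\<close>

lemma trig_polynomial_approx:
  fixes f :: "'a::euclidean_space \<Rightarrow> real"
  assumes f: "continuous_on UNIV f" and f01: "\<And>x. 0 \<le> f x" "\<And>x. f x \<le> 1" and "e > 0" "e \<le> 1"
  obtains g where "trig_polynomial g" and "\<And>x. \<bar>g x\<bar> \<le> 2"
    and "\<And>x. norm x \<le> R \<Longrightarrow> \<bar>f x - g x\<bar> \<le> e"
proof -
  interpret T: function_ring_on "Collect trig_polynomial" "cball (0::'a) R"
  proof
    fix x y :: 'a assume "x \<noteq> y"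
    then show "\<exists>f\<in>Collect trig_polynomial. f x \<noteq> f y"
      using trig_polynomial_separates by (metis mem_Collect_eq)
  qed (auto intro: trig_polynomial_continuous trig_polynomial.add trig_polynomial_mult
        trig_polynomial_const)
  obtain p where p: "trig_polynomial p" and pf: "\<And>x. norm x \<le> R \<Longrightarrow> \<bar>f x - p x\<bar> < e / 2"
    using T.Stone_Weierstrass_basic[of f "e / 2"] f \<open>e > 0\<close>
    by (force intro: continuous_on_subset)
  obtain B where B: "\<And>x. \<bar>p x\<bar> \<le> B"
    using trig_polynomial_bounded[OF p] by blast
  define clip :: "real \<Rightarrow> real" where "clip = (\<lambda>s. max 0 (min 1 s))"
  obtain q where q: "real_polynomial_function q"
    and qc: "\<And>s. s \<in> {-B..B} \<Longrightarrow> \<bar>clip s - q s\<bar> < e / 2"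
    by (rule Stone_Weierstrass_real_polynomial_function[of "{-B..B}" clip "e / 2"])
      (use \<open>e > 0\<close> in \<open>auto simp: clip_def intro!: continuous_intros\<close>)
  have *: "\<bar>clip (p x) - q (p x)\<bar> < e / 2" for x
    using B[of x] by (intro qc) auto
  show thesis
  proof
    show "trig_polynomial (\<lambda>x. q (p x))"
      by (rule trig_polynomial_compose[OF q p])
    show "\<bar>q (p x)\<bar> \<le> 2" for x
      using *[of x] \<open>e \<le> 1\<close> unfolding clip_def by (simp add: min_def max_def abs_if split: if_splits)
    show "\<bar>f x - q (p x)\<bar> \<le> e" if "norm x \<le> R" for x
    proof -
      \<comment> \<open>Clipping to the unit interval is nonexpansive and fixes the values of
        \<open>f\<close>.\<close>
      have "\<bar>f x - clip (p x)\<bar> \<le> \<bar>f x - p x\<bar>"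
        using f01[of x] by (simp add: clip_def min_def max_def abs_if)
      then show ?thesis using pf[OF that] *[of x] by linarith
    qed
  qed
qed

text \<open>The indicator of a closed set is a pointwise limit of uniformly bounded trigonometric
  polynomials, whose integrals agree. Dominated convergence gives agreement on closed sets, an
  intersection-stable generator of the Borel sets.\<close>

lemma finite_measure_eqI_char:
  fixes P Q :: "'a::euclidean_space measure"
  assumes "finite_measure P" and "finite_measure Q"
    and sets: "sets P = sets borel" "sets Q = sets borel"
    and eq: "\<And>\<xi>. (LINT x|P. iexp (\<xi> \<bullet> x)) = (LINT x|Q. iexp (\<xi> \<bullet> x))"
  shows "P = Q"
proof -
  interpret P: finite_measure P by fact
  interpret Q: finite_measure Q by fact
  note [measurable_cong] = sets
  have cos_eq: "integrable P (\<lambda>x. a * cos (\<xi> \<bullet> x + c)) \<and> integrable Q (\<lambda>x. a * cos (\<xi> \<bullet> x + c)) \<and>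
      (LINT x|P. a * cos (\<xi> \<bullet> x + c)) = (LINT x|Q. a * cos (\<xi> \<bullet> x + c))" for a c :: real and \<xi> :: 'a
  proof -
    have I: "integrable P (\<lambda>x. iexp (\<xi> \<bullet> x))" "integrable Q (\<lambda>x. iexp (\<xi> \<bullet> x))"
      by (auto intro!: P.integrable_const_bound[where B=1] Q.integrable_const_bound[where B=1])
    have *: "a * cos (\<xi> \<bullet> x + c) = Re (of_real a * iexp c * iexp (\<xi> \<bullet> x))" for x
      by (simp add: exp_add[symmetric] Re_exp algebra_simps cis_conv_exp[symmetric] cos_add)
    show ?thesis
      unfolding * using I eq[of \<xi>] by (simp add: mult.assoc del: Re_complex_of_real)
  qed
  have trig_eq: "integrable P g \<and> integrable Q g \<and> (LINT x|P. g x) = (LINT x|Q. g x)"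
    if "trig_polynomial g" for g
    using that
  proof (induction rule: trig_polynomial.induct)
    case (cos a \<xi> c)
    show ?case by (rule cos_eq)
  qed simp
  have closed_eq: "measure P F = measure Q F" if F: "closed F" for F
  proof (cases "F = {}")
    case False
    \<comment> \<open>For positive \<open>n\<close> this tent is 1 on \<open>F\<close> and 0 beyond
      distance \<open>1 / n\<close>. Nonemptiness of \<open>F\<close> matters here: the distance to
      the empty set is 0 by convention.\<close>
    define f where "f n x = max 0 (1 - real n * infdist x F)" for n x
    have f_cont: "continuous_on UNIV (f n)" for n
      unfolding f_def by (intro continuous_intros)
    have f01: "0 \<le> f n x" "f n x \<le> 1" for n x
      by (auto simp: f_def infdist_nonneg)
    have "\<exists>g. trig_polynomial g \<and> (\<forall>x. \<bar>g x\<bar> \<le> 2) \<and>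
        (\<forall>x. norm x \<le> real n \<longrightarrow> \<bar>f n x - g x\<bar> \<le> 1 / real (Suc n))" for n
    proof -
      obtain g where "trig_polynomial g" "\<And>x. \<bar>g x\<bar> \<le> 2"
          "\<And>x. norm x \<le> real n \<Longrightarrow> \<bar>f n x - g x\<bar> \<le> 1 / real (Suc n)"
        by (rule trig_polynomial_approx[of "f n" "1 / real (Suc n)" "real n"])
          (use f_cont[of n] f01[of n] in auto)
      then show ?thesis by blast
    qed
    then obtain g where g: "\<And>n. trig_polynomial (g n)" "\<And>n x. \<bar>g n x\<bar> \<le> 2"
        "\<And>n x. norm x \<le> real n \<Longrightarrow> \<bar>f n x - g n x\<bar> \<le> 1 / real (Suc n)"
      by metis
    have f_lim: "(\<lambda>n. f n x) \<longlonglongrightarrow> indicator F x" for x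
    proof (cases "x \<in> F")
      case True
      then show ?thesis by (simp add: f_def)
    next
      case out: False
      then have d: "infdist x F > 0"
        using F False infdist_pos_not_in_closed by blast
      have "eventually (\<lambda>n. f n x = 0) sequentially"
      proof -
        obtain n0 :: nat where "1 / infdist x F < n0" using reals_Archimedean2 by blast
        then have "1 < real n0 * infdist x F" using d by (simp add: field_simps)
        then have "f n x = 0" if "n \<ge> n0" for n
          using that d unfolding f_def
          by (smt (verit, best) mult_right_mono of_nat_mono)
        then show ?thesis unfolding eventually_sequentially by blast
      qed
      then show ?thesis using out by (simp add: tendsto_eventually)
    qed
    have g_lim: "(\<lambda>n. g n x) \<longlonglongrightarrow> indicator F x" for x
    proof -
      obtain n0 :: nat where n0: "norm x \<le> n0" using real_arch_simple by blast
      \<comment> \<open>From index \<open>n0\<close> on, \<open>x\<close> lies in the ball of radius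
        \<open>n\<close> on which \<open>g n\<close> approximates \<open>f n\<close>.\<close>
      have "(\<lambda>n. f n x - g n x) \<longlonglongrightarrow> 0"
      proof (rule Lim_null_comparison)
        have "norm (f n x - g n x) \<le> 1 / real (Suc n)" if "n \<ge> n0" for n
          using g(3)[of x n] n0 that by simp
        then show "eventually (\<lambda>n. norm (f n x - g n x) \<le> 1 / real (Suc n)) sequentially"
          unfolding eventually_sequentially by blast
        show "(\<lambda>n. 1 / real (Suc n)) \<longlonglongrightarrow> 0"
          using LIMSEQ_inverse_real_of_nat by (simp add: inverse_eq_divide)
      qed
      from tendsto_diff[OF f_lim[of x] this] show ?thesis by simp
    qed
    have [measurable]: "g n \<in> borel_measurable borel" for n
      using trig_polynomial_continuous[OF g(1)] by (rule borel_measurable_continuous_onI)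
    have [measurable]: "F \<in> sets borel" using F by simp
    have "(\<lambda>n. LINT x|P. g n x) \<longlonglongrightarrow> (LINT x|P. indicator F x)"
      by (rule integral_dominated_convergence[where w="\<lambda>_. 2"]) (auto simp: g g_lim)
    moreover have "(\<lambda>n. LINT x|P. g n x) \<longlonglongrightarrow> (LINT x|Q. indicator F x)"
      unfolding trig_eq[OF g(1), THEN conjunct2, THEN conjunct2]
      by (rule integral_dominated_convergence[where w="\<lambda>_. 2"]) (auto simp: g g_lim)
    ultimately have "(LINT x|P. indicator F x :: real) = (LINT x|Q. indicator F x)"
      by (rule LIMSEQ_unique)
    then show ?thesis by (simp add: sets_eq_imp_space_eq[OF sets(1)] sets_eq_imp_space_eq[OF sets(2)])
  qed simp
  show "P = Q"
  proof (rule measure_eqI_generator_eq[where E="Collect closed" and \<Omega>=UNIV and A="\<lambda>_. UNIV"])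
    show "Int_stable (Collect closed :: 'a set set)"
      by (auto simp: Int_stable_def)
    show "sets P = sigma_sets UNIV (Collect closed)" "sets Q = sigma_sets UNIV (Collect closed)"
      unfolding sets borel_eq_closed by simp_all
    show "emeasure P X = emeasure Q X" if "X \<in> Collect closed" for X
      using closed_eq that by (simp add: P.emeasure_eq_measure Q.emeasure_eq_measure)
  qed auto
qed

subsection \<open>Central differences of the exponential\<close>

text \<open>The symmetric second difference times -1/2, normalised so that its eigenvalue on
  \<open>iexp\<close> is \<open>1 - cos s\<close>.\<close>

definition central_diff :: "real \<Rightarrow> (real \<Rightarrow> complex) \<Rightarrow> real \<Rightarrow> complex" where
  "central_diff s f t = f t - (f (t + s) + f (t - s)) / 2"

lemma central_diff_pow_diff:
  "(central_diff s ^^ k) (\<lambda>t. f t - g t) = (\<lambda>t. (central_diff s ^^ k) f t - (central_diff s ^^ k) g t)"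
  by (induction k) (simp_all add: central_diff_def[abs_def] fun_eq_iff diff_divide_distrib
      add_divide_distrib)

lemma central_diff_pow_cmult:
  "(central_diff s ^^ k) (\<lambda>t. c * f t) = (\<lambda>t. c * (central_diff s ^^ k) f t)"
  by (induction k) (simp_all add: central_diff_def[abs_def] fun_eq_iff distrib_left right_diff_distrib
      add_divide_distrib)

lemma central_diff_pow_sum:
  "(central_diff s ^^ k) (\<lambda>t. \<Sum>i\<in>I. f i t) = (\<lambda>t. \<Sum>i\<in>I. (central_diff s ^^ k) (f i) t)"
  by (induction k)
    (simp_all add: central_diff_def[abs_def] sum.distrib sum_subtractf sum_divide_distrib add_divide_distrib)

text \<open>In the binomial expansion of both shifts the top power cancels against
  \<open>t ^ n\<close>, so the degree drops.\<close>

lemma central_diff_monomial: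
  "central_diff s (\<lambda>t. of_real t ^ n) =
    (\<lambda>t. \<Sum>i<n. - (of_nat (n choose i) * (of_real s ^ (n - i) + of_real (- s) ^ (n - i)) / 2) * of_real t ^ i)"
proof
  fix t :: real
  have expand: "of_real (t + u) ^ n = of_real t ^ n +
      (\<Sum>i<n. of_nat (n choose i) * of_real u ^ (n - i) * of_real t ^ i :: complex)" for u
    by (simp add: binomial_ring lessThan_Suc_atMost[symmetric] algebra_simps)
  show "central_diff s (\<lambda>t. of_real t ^ n) t =
    (\<Sum>i<n. - (of_nat (n choose i) * (of_real s ^ (n - i) + of_real (- s) ^ (n - i)) / 2) * of_real t ^ i)"
    unfolding central_diff_def expand[of s] diff_conv_add_uminus[of t s] expand[of "- s"]
    by (simp add: sum.distrib sum_subtractf sum_negf sum_divide_distrib distrib_left distrib_right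
        add_divide_distrib left_diff_distrib)
qed

text \<open>Each difference leaves only lower powers, so the induction runs over all degrees at
  once, peeling off the innermost difference.\<close>

lemma central_diff_pow_monomial:
  "n < k \<Longrightarrow> (central_diff s ^^ k) (\<lambda>t. of_real t ^ n) = (\<lambda>_. 0)"
proof (induction k arbitrary: n)
  case (Suc k)
  have "(central_diff s ^^ k) (\<lambda>t. of_real t ^ i) = (\<lambda>_. 0)" if "i < n" for i
    using Suc that by simp
  then show ?case
    unfolding funpow_Suc_right o_def central_diff_monomial central_diff_pow_sum central_diff_pow_cmult
    by simp
qed simp

text \<open>Shifting multiplies the exponential by a constant, and the average of
  \<open>iexp s\<close> and \<open>iexp (- s)\<close> is \<open>cos s\<close>; hence it is an
  eigenfunction.\<close>

lemma central_diff_pow_iexp: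
  "(central_diff s ^^ k) iexp = (\<lambda>t. of_real ((1 - cos s) ^ k) * iexp t)"
proof (induction k)
  case (Suc k)
  have step: "central_diff s (\<lambda>t. c * iexp t) t = c * of_real (1 - cos s) * iexp t" for c t
  proof -
    have "(iexp s + iexp (- s)) / 2 = of_real (cos s)"
      by (simp add: cos_exp_eq exp_of_real cos_of_real[symmetric] del: cos_of_real)
    moreover have "central_diff s (\<lambda>t. c * iexp t) t = c * (1 - (iexp s + iexp (- s)) / 2) * iexp t"
      by (simp add: central_diff_def distrib_left right_diff_distrib exp_add exp_diff exp_minus field_simps)
    ultimately show ?thesis by simp
  qed
  have "central_diff s (\<lambda>t. of_real ((1 - cos s) ^ k) * iexp t) =
      (\<lambda>t. of_real ((1 - cos s) ^ Suc k) * iexp t)"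
    unfolding fun_eq_iff using step by simp
  then show ?case by (simp only: funpow.simps o_apply Suc)
qed simp

text \<open>This is the function \<open>G\<close> of the outline: of order \<open>m + 1\<close> at 0
  and of growth at most \<open>m\<close> at infinity, which fits a mass scaling like
  \<open>t powr (- \<beta>)\<close> with \<open>m < \<beta> < m + 1\<close>.\<close>

definition iexp_rem :: "nat \<Rightarrow> real \<Rightarrow> complex" where
  "iexp_rem m t = iexp t - (\<Sum>k\<le>m. (\<i> * t) ^ k / fact k)"

text \<open>More than \<open>m\<close> differences annihilate the Taylor polynomial of degree
  \<open>m\<close>, and only the eigenvalue factor of the exponential survives.\<close>

lemma central_diff_pow_iexp_rem:
  assumes "m < k"
  shows "(central_diff s ^^ k) (iexp_rem m) t = of_real ((1 - cos s) ^ k) * iexp t"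
proof -
  have rem: "iexp_rem m = (\<lambda>t. iexp t - (\<Sum>k\<le>m. (\<i> ^ k / fact k) * of_real t ^ k))"
    by (simp add: fun_eq_iff iexp_rem_def power_mult_distrib)
  have "(central_diff s ^^ k) (\<lambda>t. of_real t ^ i) = (\<lambda>_. 0)" if "i \<le> m" for i
    using assms that by (intro central_diff_pow_monomial) simp
  then show ?thesis
    unfolding rem central_diff_pow_diff central_diff_pow_sum central_diff_pow_cmult central_diff_pow_iexp
    by simp
qed

text \<open>Combines the two Taylor estimates, of orders \<open>m\<close> and \<open>m + 1\<close>;
  adding their constants makes one factor serve both. It is applied with
  \<open>a = norm \<xi>\<close> and \<open>b = norm x\<close>.\<close>

lemma norm_iexp_rem_le:
  assumes "\<bar>t\<bar> \<le> a * b" and "a \<ge> 0" and "b \<ge> 0"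
  shows "norm (iexp_rem m t) \<le> (2 * a ^ m + a ^ Suc m) * min (b ^ m) (b ^ Suc m)"
proof -
  have p: "\<bar>t\<bar> ^ n \<le> a ^ n * b ^ n" for n
    using power_mono[OF assms(1), of n] by (simp add: power_mult_distrib)
  have f: "x / fact n \<le> x" if "x \<ge> 0" for x :: real and n
    using that by (simp add: divide_le_eq mult_le_cancel_left1 fact_ge_1)
  have "norm (iexp_rem m t) \<le> 2 * \<bar>t\<bar> ^ m"
    using iexp_approx2[of t m] f[of "2 * \<bar>t\<bar> ^ m" m] unfolding iexp_rem_def by simp
  also have "\<dots> \<le> 2 * a ^ m * b ^ m" using p[of m] by simp
  finally have 1: "norm (iexp_rem m t) \<le> 2 * a ^ m * b ^ m" .
  have "norm (iexp_rem m t) \<le> \<bar>t\<bar> ^ Suc m"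
    using iexp_approx1[of t m] f[of "\<bar>t\<bar> ^ Suc m" "Suc m"] unfolding iexp_rem_def
    by (meson abs_ge_zero order_trans zero_le_power)
  also have "\<dots> \<le> a ^ Suc m * b ^ Suc m" using p[of "Suc m"] by simp
  finally have 2: "norm (iexp_rem m t) \<le> a ^ Suc m * b ^ Suc m" .
  have "0 \<le> a ^ n * b ^ k" for n k using assms by simp
  then show ?thesis
    using 1 2 unfolding min_def by (smt (verit) distrib_right)
qed

lemma iexp_rem_0: "iexp_rem m 0 = 0"
  by (simp add: iexp_rem_def power_0_left if_distrib[of "\<lambda>x. x / _"] sum.delta cong: if_cong)

subsection \<open>Homogeneous measures\<close>

lemma mutually_singular_sym:
  assumes "mutually_singular M N" and "sets M = sets N"
  shows "mutually_singular N M"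
proof -
  obtain S where S: "S \<in> sets M" "emeasure M S = 0" "emeasure N (space N - S) = 0"
    using assms(1) unfolding mutually_singular_def by blast
  have sp: "space M = space N" by (rule sets_eq_imp_space_eq[OF assms(2)])
  have "space M - (space N - S) = S"
    using sets.sets_into_space[OF S(1)] sp by auto
  moreover have "space N - S \<in> sets N" using S(1) assms(2) by auto
  ultimately show ?thesis
    using S unfolding mutually_singular_def by (intro bexI[of _ "space N - S"]) auto
qed

lemma signed_val_swap: "signed_val N M A = - signed_val M N A"
  by (simp add: signed_val_def)

lemma homogeneous_signed_swap:
  "homogeneous_signed M N \<alpha> \<Longrightarrow> homogeneous_signed N M \<alpha>"
  unfolding homogeneous_signed_def signed_val_swap[of N M] by simp

lemma loc_finite_away0_finite:
  assumes M: "loc_finite_away0 M" and "bounded A" "0 \<notin> closure A"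
  shows "emeasure M A < \<infinity>"
proof -
  have "emeasure M (closure A) < \<infinity>"
    using M assms(2,3) unfolding loc_finite_away0_def by (metis compact_closure)
  moreover have "emeasure M A \<le> emeasure M (closure A)"
    using M closure_subset[of A] by (intro emeasure_mono) (auto simp: loc_finite_away0_def)
  ultimately show ?thesis by order
qed

text \<open>By uniqueness of the Jordan decomposition the positive part inherits the homogeneity.\<close>

lemma homogeneous_positive_part_le:
  fixes M N :: "'a::euclidean_space measure"
  assumes M: "loc_finite_away0 M" and N: "loc_finite_away0 N"
    and sing: "mutually_singular M N" and hom: "homogeneous_signed M N \<alpha>"
    and "t > 0" and A: "A \<in> sets borel" "bounded A" "0 \<notin> closure A"
  shows "measure M ((*\<^sub>R) t ` A) \<le> t powr (\<alpha> + real DIM('a)) * measure M A"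
proof -
  have sets: "sets M = sets borel" "sets N = sets borel"
    using M N by (auto simp: loc_finite_away0_def)
  then have sp: "space N = UNIV"
    by (metis sets_eq_imp_space_eq space_borel)
  obtain S where S: "S \<in> sets borel" "emeasure M S = 0" "emeasure N (- S) = 0"
    using sing unfolding mutually_singular_def sp sets Compl_eq_Diff_UNIV by blast
  \<comment> \<open>The part of \<open>A\<close> whose dilate avoids \<open>S\<close>. Since
    \<open>S\<close> is null for \<open>M\<close> and carries \<open>N\<close>, the dilate of
    \<open>B\<close> keeps the \<open>M\<close>-mass of the dilate of \<open>A\<close> and has no
    \<open>N\<close>-mass.\<close>
  define B where "B = A \<inter> (\<lambda>x. t *\<^sub>R x) -` (- S)"
  have "(\<lambda>x. t *\<^sub>R x) -` (- S) \<inter> space borel \<in> sets (borel :: 'a measure)"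
    by (rule measurable_sets[of _ _ borel]) (use S(1) in auto)
  then have B: "B \<in> sets borel" "B \<subseteq> A" using A(1) by (auto simp: B_def)
  have B': "bounded B" "0 \<notin> closure B"
    using B(2) A bounded_subset closure_mono by blast+
  have tB: "(*\<^sub>R) t ` B = (*\<^sub>R) t ` A - S"
    by (auto simp: B_def)
  have tA: "(*\<^sub>R) t ` A \<in> sets borel"
  proof -
    have "(*\<^sub>R) t ` A = (\<lambda>x. (1 / t) *\<^sub>R x) -` A \<inter> space borel"
      using \<open>t > 0\<close> by (force simp: image_iff)
    then show ?thesis
      using measurable_sets[of "\<lambda>x::'a. (1 / t) *\<^sub>R x" borel borel A] A(1) by simp
  qed
  have "measure M ((*\<^sub>R) t ` A) = measure M ((*\<^sub>R) t ` A - S)"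
    by (rule measure_Diff_null_set[symmetric]) (use tA S sets in \<open>auto simp: null_sets_def\<close>)
  moreover have "measure N ((*\<^sub>R) t ` A - S) = 0"
  proof -
    have "emeasure N ((*\<^sub>R) t ` A - S) \<le> emeasure N (- S)"
      using S(1) sets by (intro emeasure_mono) auto
    then show ?thesis using S(3) by (simp add: measure_def)
  qed
  moreover have "signed_val M N ((*\<^sub>R) t ` B) = t powr (\<alpha> + real DIM('a)) * signed_val M N B"
    using hom \<open>t > 0\<close> B(1) B' unfolding homogeneous_signed_def by blast
  ultimately have "measure M ((*\<^sub>R) t ` A) = t powr (\<alpha> + real DIM('a)) * (measure M B - measure N B)"
    by (simp add: tB signed_val_def)
  also have "\<dots> \<le> t powr (\<alpha> + real DIM('a)) * measure M A"
  proof (rule mult_left_mono)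
    have "measure M B \<le> measure M A"
      using B A loc_finite_away0_finite[OF M A(2,3)] sets
      by (intro measure_mono_fmeasurable) (auto simp: fmeasurable_def)
    \<comment> \<open>Discarding the nonnegative \<open>N\<close>-term gives up equality but keeps
      the upper bound that integrability uses.\<close>
    then show "measure M B - measure N B \<le> measure M A"
      using measure_nonneg[of N B] by linarith
  qed simp
  finally show ?thesis .
qed

text \<open>Almost everywhere \<open>f\<close> is dominated by the sum of the constants
  \<open>c j\<close> times the indicators of \<open>A j\<close>, and this sum has finite integral.
  Overlaps in the cover are harmless.\<close>

lemma integrable_if_summable_cover:
  fixes f :: "'a \<Rightarrow> real"
  assumes f [measurable]: "f \<in> borel_measurable M" and A [measurable]: "\<And>j. A j \<in> sets M"
    and fin: "\<And>j. emeasure M (A j) < \<infinity>" and c: "\<And>j. 0 \<le> c j"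
    and sum: "summable (\<lambda>j::nat. c j * measure M (A j))"
    and bound: "AE x in M. f x \<noteq> 0 \<longrightarrow> (\<exists>j. x \<in> A j \<and> \<bar>f x\<bar> \<le> c j)"
  shows "integrable M f"
proof (rule integrableI_bounded)
  have "(\<integral>\<^sup>+x. norm (f x) \<partial>M) \<le> (\<integral>\<^sup>+x. (\<Sum>j. ennreal (c j) * indicator (A j) x) \<partial>M)"
  proof (rule nn_integral_mono_AE, use bound in eventually_elim)
    case (elim x)
    show ?case
    proof (cases "f x = 0")
      case False
      then obtain j where j: "x \<in> A j" "\<bar>f x\<bar> \<le> c j" using elim by blast
      define a where "a i = ennreal (c i) * indicator (A i) x" for i
      have "ennreal (norm (f x)) \<le> a j"
        using j by (simp add: a_def ennreal_leI)
      also have "\<dots> \<le> (\<Sum>i. a i)"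
        using sum_le_suminf[of a "{j}"] by simp
      finally show ?thesis unfolding a_def .
    qed simp
  qed
  also have "\<dots> = (\<Sum>j. ennreal (c j) * emeasure M (A j))"
    by (subst nn_integral_suminf) (auto simp: nn_integral_cmult_indicator)
  also have "\<dots> = (\<Sum>j. ennreal (c j * measure M (A j)))"
  proof -
    have "emeasure M (A j) = ennreal (measure M (A j))" for j
      using fin[of j] by (intro emeasure_eq_ennreal_measure) auto
    then show ?thesis using c by (simp add: ennreal_mult)
  qed
  also have "\<dots> = ennreal (\<Sum>j. c j * measure M (A j))"
    using c by (intro suminf_ennreal_eq summable_sums sum) simp
  also have "\<dots> < \<infinity>" by simp
  finally show "(\<integral>\<^sup>+x. norm (f x) \<partial>M) < \<infinity>" .
qed simp

lemma exists_dyadic_bracket: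
  fixes r :: real
  assumes "1 \<le> r"
  obtains j :: nat where "2 ^ j \<le> r" and "r \<le> 2 ^ Suc j"
proof -
  obtain n0 where n0: "r < 2 ^ n0" using real_arch_pow[of 2 r] by auto
  define n where "n = (LEAST n. r < 2 ^ n)"
  have n: "r < 2 ^ n" unfolding n_def by (rule LeastI[of _ n0]) (rule n0)
  then obtain j where j: "n = Suc j" using assms by (cases n) auto
  have "\<not> r < 2 ^ j"
    using not_less_Least[of j "\<lambda>n. r < 2 ^ n"] j unfolding n_def by simp
  with n j show thesis by (intro that[of j]) simp_all
qed

text \<open>On dyadic shells the integral is bounded by a geometric series: outward it converges
  because \<open>m < \<beta>\<close>, inward because \<open>\<beta> < m + 1\<close>.\<close>

lemma integrable_min_norm_power:
  fixes M :: "'a::euclidean_space measure"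
  assumes M: "loc_finite_away0 M"
    and scale: "\<And>t A. t > 0 \<Longrightarrow> A \<in> sets borel \<Longrightarrow> bounded A \<Longrightarrow> 0 \<notin> closure A \<Longrightarrow>
      measure M ((*\<^sub>R) t ` A) \<le> t powr (- \<beta>) * measure M A"
    and m: "real m < \<beta>" "\<beta> < real (Suc m)"
  shows "integrable M (\<lambda>x. min (norm x ^ m) (norm x ^ Suc m))"
proof -
  have sets [measurable_cong]: "sets M = sets borel"
    using M by (simp add: loc_finite_away0_def)
  define K :: "real \<Rightarrow> 'a set" where "K t = {x. t \<le> norm x \<and> norm x \<le> 2 * t}" for t
  have K_closed: "closed (K t)" for t
    unfolding K_def by (intro closed_Collect_conj closed_Collect_le continuous_intros)
  have K_bounded: "bounded (K t)" for t
    unfolding K_def bounded_iff by blast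
  have K_meas [measurable]: "K t \<in> sets M" for t
    using K_closed sets by auto
  have K_fin: "emeasure M (K t) < \<infinity>" if "t > 0" for t
    using that by (intro loc_finite_away0_finite[OF M K_bounded]) (simp add: closure_closed[OF K_closed], simp add: K_def)
  define \<kappa> where "\<kappa> = measure M (K 1)"
  have K_le: "measure M (K t) \<le> t powr (- \<beta>) * \<kappa>" if "t > 0" for t
  proof -
    have "K t = (*\<^sub>R) t ` K 1"
    proof -
      have "x \<in> (*\<^sub>R) t ` K 1" if x: "x \<in> K t" for x
        using \<open>t > 0\<close> x by (intro image_eqI[of _ _ "(1 / t) *\<^sub>R x"]) (auto simp: K_def field_simps)
      then show ?thesis using \<open>t > 0\<close> by (auto simp: K_def)
    qed
    moreover have "0 \<notin> closure (K 1)" unfolding closure_closed[OF K_closed] by (simp add: K_def)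
    ultimately show ?thesis
      unfolding \<kappa>_def using scale[OF that, of "K 1"] K_closed[of 1] K_bounded[of 1] by simp
  qed
  have [simp]: "\<kappa> \<ge> 0" by (simp add: \<kappa>_def)
  \<comment> \<open>The minimum is the power \<open>m\<close> outside the unit ball and the power
    \<open>m + 1\<close> inside, so the two regimes are treated separately.\<close>
  let ?f = "\<lambda>x::'a. if 1 \<le> norm x then norm x ^ m else 0"
  let ?g = "\<lambda>x::'a. if norm x < 1 then norm x ^ Suc m else 0"
  have "integrable M ?f"
  proof (rule integrable_if_summable_cover[where A="\<lambda>j. K (2 ^ j)" and c="\<lambda>j. (2 ^ Suc j) ^ m"])
    show "summable (\<lambda>j::nat. (2 ^ Suc j) ^ m * measure M (K (2 ^ j)))"
    proof (rule summable_comparison_test')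
      \<comment> \<open>One step outward multiplies the integrand bound by \<open>2 ^ m\<close> and
        the mass bound by \<open>2 powr (- \<beta>)\<close>.\<close>
      define q where "q = (2::real) powr (real m - \<beta>)"
      have "0 \<le> q" "q < 1" using m by (auto simp: q_def powr_less_one)
      then show "summable (\<lambda>j. 2 ^ m * \<kappa> * q ^ j)"
        by (intro summable_mult summable_geometric) auto
      fix j :: nat assume "0 \<le> j"
      have "(2 ^ Suc j) ^ m * measure M (K (2 ^ j)) \<le> (2 ^ Suc j) ^ m * ((2 ^ j) powr (- \<beta>) * \<kappa>)"
        by (intro mult_left_mono K_le) auto
      also have "\<dots> = 2 ^ m * \<kappa> * q ^ j"
      proof -
        have "q ^ j = (2 ^ j) ^ m * (2 ^ j) powr (- \<beta>)"
          unfolding q_def by (simp add: powr_realpow[symmetric] powr_powr powr_add[symmetric] algebra_simps)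
        then show ?thesis by (simp add: power_mult_distrib)
      qed
      finally show "norm ((2 ^ Suc j) ^ m * measure M (K (2 ^ j))) \<le> 2 ^ m * \<kappa> * q ^ j" by simp
    qed
    show "AE x in M. ?f x \<noteq> 0 \<longrightarrow> (\<exists>j. x \<in> K (2 ^ j) \<and> \<bar>?f x\<bar> \<le> (2 ^ Suc j) ^ m)"
    proof (intro AE_I2 impI)
      fix x assume "?f x \<noteq> 0"
      then have "1 \<le> norm x" by (auto split: if_splits)
      then obtain j where j: "2 ^ j \<le> norm x" "norm x \<le> 2 ^ Suc j" by (rule exists_dyadic_bracket)
      have "norm x ^ m \<le> (2 ^ Suc j) ^ m" using j(2) by (rule power_mono) simp
      then show "\<exists>j. x \<in> K (2 ^ j) \<and> \<bar>?f x\<bar> \<le> (2 ^ Suc j) ^ m"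
        using j by (intro exI[of _ j]) (simp add: K_def)
    qed
  qed (use K_fin in auto)
  moreover have "integrable M ?g"
  proof (rule integrable_if_summable_cover[where A="\<lambda>j. K (1 / 2 ^ Suc j)" and c="\<lambda>j. (1 / 2 ^ j) ^ Suc m"])
    show "summable (\<lambda>j::nat. (1 / 2 ^ j) ^ Suc m * measure M (K (1 / 2 ^ Suc j)))"
    proof (rule summable_comparison_test')
      \<comment> \<open>One step inward multiplies the integrand bound by
        \<open>2 ^ (- (m + 1))\<close> and the mass bound by \<open>2 powr \<beta>\<close>.\<close>
      define q where "q = (2::real) powr (\<beta> - real (Suc m))"
      have "0 \<le> q" "q < 1" using m by (auto simp: q_def powr_less_one)
      then show "summable (\<lambda>j. 2 powr \<beta> * \<kappa> * q ^ j)"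
        by (intro summable_mult summable_geometric) auto
      fix j :: nat assume "0 \<le> j"
      have "(1 / 2 ^ j) ^ Suc m * measure M (K (1 / 2 ^ Suc j))
          \<le> (1 / 2 ^ j) ^ Suc m * ((1 / 2 ^ Suc j) powr (- \<beta>) * \<kappa>)"
        by (intro mult_left_mono K_le) auto
      also have "\<dots> = 2 powr \<beta> * \<kappa> * q ^ j"
      proof -
        have "q ^ j = (2 powr - real j) powr (real (Suc m)) * (2 powr real j) powr \<beta>"
          unfolding q_def by (simp add: powr_realpow[symmetric] powr_powr powr_add[symmetric] algebra_simps)
        moreover have "(1 / 2 ^ Suc j) powr (- \<beta>) = 2 powr \<beta> * ((2::real) powr real j) powr \<beta>"
        proof -
          have "(1 / 2 ^ Suc j :: real) = 2 powr (- real (Suc j))"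
            by (subst powr_minus) (simp add: powr_realpow divide_inverse del: of_nat_Suc power_Suc)
          then show ?thesis by (simp add: powr_powr powr_add[symmetric] algebra_simps)
        qed
        moreover have "(1 / 2 ^ j :: real) ^ Suc m = (2 powr - real j) powr (real (Suc m))"
          by (subst powr_realpow) (auto simp: powr_minus powr_realpow divide_inverse)
        ultimately show ?thesis by (simp only: mult_ac)
      qed
      finally show "norm ((1 / 2 ^ j) ^ Suc m * measure M (K (1 / 2 ^ Suc j))) \<le> 2 powr \<beta> * \<kappa> * q ^ j"
        by simp
    qed
    show "AE x in M. ?g x \<noteq> 0 \<longrightarrow> (\<exists>j. x \<in> K (1 / 2 ^ Suc j) \<and> \<bar>?g x\<bar> \<le> (1 / 2 ^ j) ^ Suc m)"
    proof (intro AE_I2 impI)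
      fix x assume "?g x \<noteq> 0"
      \<comment> \<open>The positive exponent \<open>Suc m\<close> makes \<open>?g\<close> vanish at
        the origin, so bracketing \<open>1 / norm x\<close> finds an inner shell.\<close>
      then have x: "0 < norm x" "norm x < 1" by (auto split: if_splits)
      then have "1 \<le> 1 / norm x" by simp
      then obtain j where j: "2 ^ j \<le> 1 / norm x" "1 / norm x \<le> 2 ^ Suc j" by (rule exists_dyadic_bracket)
      have "norm x \<le> 1 / 2 ^ j" "1 / 2 ^ Suc j \<le> norm x"
        using j x(1) by (simp_all add: field_simps)
      moreover from this(1) have "norm x ^ Suc m \<le> (1 / 2 ^ j) ^ Suc m" by (rule power_mono) simp
      ultimately show "\<exists>j. x \<in> K (1 / 2 ^ Suc j) \<and> \<bar>?g x\<bar> \<le> (1 / 2 ^ j) ^ Suc m"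
        using x by (intro exI[of _ j]) (simp add: K_def)
    qed
  qed (use K_fin in auto)
  ultimately have "integrable M (\<lambda>x. ?f x + ?g x)" by (rule Bochner_Integration.integrable_add)
  then show ?thesis
  proof (rule Bochner_Integration.integrable_bound)
    show "AE x in M. norm (min (norm x ^ m) (norm x ^ Suc m)) \<le> norm (?f x + ?g x)"
      by (rule AE_I2) (auto simp: min_def)
  qed measurable
qed

subsection \<open>Measures agreeing on halfspaces\<close>

text \<open>Nonempty open sets are not null. This extracts good pairs of direction and offset from
  the almost-everywhere hypothesis.\<close>

lemma open_meets_AE_lborel:
  fixes U :: "'a::euclidean_space set"
  assumes "AE z in lborel. P z" and "open U" and "U \<noteq> {}"
  obtains z where "z \<in> U" and "P z"
proof -
  have "U \<notin> null_sets lborel"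
    using open_not_negligible[OF assms(2,3)] assms(2)
    by (simp add: negligible_iff_null_sets null_sets_completion_iff)
  moreover have "U \<in> null_sets lborel" if "\<forall>z\<in>U. \<not> P z"
  proof -
    have "AE z in lborel. z \<notin> U"
      using assms(1) by eventually_elim (use that in blast)
    then show ?thesis
      using assms(2) by (subst (asm) AE_iff_null) (auto simp: space_lborel)
  qed
  ultimately show thesis using that by blast
qed

lemma halfspace_borel [measurable]: "halfspace \<xi> p \<in> sets borel"
  unfolding halfspace_def by (intro borel_open open_Collect_less continuous_intros)

text \<open>The approximating halfspaces have offsets decreasing to \<open>p\<close>, with directions converging faster
  than the offsets, so that the indicator functions converge on the bounding hyperplane as well.\<close>

lemma halfspace_seq_lim:
  fixes \<xi> :: "'a::euclidean_space"
  assumes M: "sets M = sets borel" "\<And>r. r > 0 \<Longrightarrow> emeasure M {x. r \<le> norm x} < \<infinity>"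
    and "p > 0" and z: "\<And>n. p < snd (z n)" "(\<lambda>n. snd (z n)) \<longlonglongrightarrow> p"
      "\<And>n. norm (fst (z n) - \<xi>) * real (Suc n) < snd (z n) - p" "\<And>n. snd (z n) - p < 1"
  shows "(\<lambda>n. measure M (halfspace (fst (z n)) (snd (z n)))) \<longlonglongrightarrow> measure M (halfspace \<xi> p)"
proof -
  note [measurable_cong] = M(1)
  \<comment> \<open>Directions have norm at most \<open>norm \<xi> + 1\<close> and offsets exceed
    \<open>p\<close>, so all halfspaces of the sequence stay outside the ball of radius
    \<open>r\<close>; the indicator of that region dominates.\<close>
  define r where "r = p / (norm \<xi> + 1)"
  have "r > 0" using \<open>p > 0\<close> by (simp add: r_def add_nonneg_pos)
  have lim: "(\<lambda>n. indicator (halfspace (fst (z n)) (snd (z n))) x :: real)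
      \<longlonglongrightarrow> indicator (halfspace \<xi> p) x" for x
  proof (cases "\<xi> \<bullet> x > p")
    case True
    have "(\<lambda>n. norm (fst (z n) - \<xi>)) \<longlonglongrightarrow> 0"
    proof (rule Lim_null_comparison)
      have *: "norm (fst (z n) - \<xi>) * 1 \<le> norm (fst (z n) - \<xi>) * real (Suc n)" for n
        by (intro mult_left_mono) auto
      have "norm (fst (z n) - \<xi>) \<le> snd (z n) - p" for n
        using *[of n] z(3)[of n] by linarith
      then show "eventually (\<lambda>n. norm (norm (fst (z n) - \<xi>)) \<le> snd (z n) - p) sequentially"
        by simp
      show "(\<lambda>n. snd (z n) - p) \<longlonglongrightarrow> 0" using z(2) by (simp add: LIM_zero)
    qed
    then have "(\<lambda>n. fst (z n)) \<longlonglongrightarrow> \<xi>"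
      using LIM_zero_cancel tendsto_norm_zero_iff by blast
    then have "(\<lambda>n. fst (z n) \<bullet> x - snd (z n)) \<longlonglongrightarrow> \<xi> \<bullet> x - p"
      by (intro tendsto_intros z(2))
    then have "eventually (\<lambda>n. fst (z n) \<bullet> x - snd (z n) > 0) sequentially"
      using True by (intro order_tendstoD(1)) auto
    then have "eventually (\<lambda>n. indicator (halfspace (fst (z n)) (snd (z n))) x = (1::real)) sequentially"
      by eventually_elim (simp add: halfspace_def)
    then show ?thesis using True by (simp add: tendsto_eventually halfspace_def)
  next
    case False
    obtain n0 :: nat where n0: "norm x \<le> n0" using real_arch_simple by blast
    \<comment> \<open>Once \<open>n\<close> exceeds \<open>norm x\<close>, tilting the direction
      gains less than the offset excess \<open>snd (z n) - p\<close>. This covers the hyperplane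
      itself.\<close>
    have "fst (z n) \<bullet> x \<le> snd (z n)" if "n \<ge> n0" for n
    proof -
      have "(fst (z n) - \<xi>) \<bullet> x \<le> norm (fst (z n) - \<xi>) * norm x" by (rule norm_cauchy_schwarz)
      also have "\<dots> \<le> norm (fst (z n) - \<xi>) * real (Suc n)"
        using n0 that by (intro mult_left_mono) auto
      finally show ?thesis using z(3)[of n] False by (simp add: inner_diff_left)
    qed
    then have "indicator (halfspace (fst (z n)) (snd (z n))) x = (0::real)" if "n \<ge> n0" for n
      using that by (force simp: halfspace_def indicator_def)
    then have "eventually (\<lambda>n. indicator (halfspace (fst (z n)) (snd (z n))) x = (0::real)) sequentially"
      unfolding eventually_sequentially by blast
    then show ?thesis using False by (simp add: tendsto_eventually halfspace_def)
  qed
  have sub: "r \<le> norm x" if "x \<in> halfspace (fst (z n)) (snd (z n))" for x n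
  proof -
    have "p < fst (z n) \<bullet> x" using that z(1)[of n] by (simp add: halfspace_def)
    also have "\<dots> \<le> norm (fst (z n)) * norm x" by (rule norm_cauchy_schwarz)
    also have "\<dots> \<le> (norm \<xi> + 1) * norm x"
    proof (rule mult_right_mono)
      have "norm (fst (z n) - \<xi>) * 1 \<le> norm (fst (z n) - \<xi>) * real (Suc n)"
        by (intro mult_left_mono) auto
      then have "norm (fst (z n) - \<xi>) < 1" using z(3,4)[of n] by linarith
      then show "norm (fst (z n)) \<le> norm \<xi> + 1" using norm_triangle_sub[of "fst (z n)" \<xi>] by linarith
    qed simp
    finally show ?thesis by (simp add: r_def divide_le_eq add_nonneg_pos mult.commute)
  qed
  have [measurable]: "{x::'a. r \<le> norm x} \<in> sets borel" by measurable
  have "(\<lambda>n. LINT x|M. indicator (halfspace (fst (z n)) (snd (z n))) x :: real)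
      \<longlonglongrightarrow> (LINT x|M. indicator (halfspace \<xi> p) x)"
  proof (rule integral_dominated_convergence[where w="indicator {x. r \<le> norm x}"])
    show "integrable M (indicator {x. r \<le> norm x} :: 'a \<Rightarrow> real)"
      using M \<open>r > 0\<close> by (intro integrable_real_indicator) auto
    show "AE x in M. norm (indicator (halfspace (fst (z n)) (snd (z n))) x :: real) \<le> indicator {x. r \<le> norm x} x" for n
      using sub by (auto simp: indicator_def)
  qed (use lim in \<open>auto simp: M(1)\<close>)
  moreover have "space M = UNIV" using sets_eq_imp_space_eq[OF M(1)] by simp
  ultimately show ?thesis by simp
qed

text \<open>Good pairs approach \<open>(\<xi>, p)\<close> from inside open sets; both measures are
  continuous along such a sequence, so equality extends to every direction and positive
  offset.\<close>

lemma measure_halfspace_eq: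
  fixes \<xi> :: "'a::euclidean_space"
  assumes M: "sets M = sets borel" "\<And>r. r > 0 \<Longrightarrow> emeasure M {x. r \<le> norm x} < \<infinity>"
    and N: "sets N = sets borel" "\<And>r. r > 0 \<Longrightarrow> emeasure N {x. r \<le> norm x} < \<infinity>"
    and ae: "AE z in (lborel :: ('a \<times> real) measure).
           snd z > 0 \<longrightarrow> emeasure M (halfspace (fst z) (snd z)) = emeasure N (halfspace (fst z) (snd z))"
    and "p > 0"
  shows "measure M (halfspace \<xi> p) = measure N (halfspace \<xi> p)"
proof -
  \<comment> \<open>A thin open cone above \<open>(\<xi>, p)\<close>, encoding the rates that
    \<open>halfspace_seq_lim\<close> asks for.\<close>
  define U :: "nat \<Rightarrow> ('a \<times> real) set"
    where "U n = {z. p < snd z \<and> snd z - p < 1 / real (Suc n) \<and>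
      norm (fst z - \<xi>) * real (Suc n) < snd z - p}" for n
  have "\<exists>z\<in>U n. snd z > 0 \<longrightarrow> emeasure M (halfspace (fst z) (snd z)) = emeasure N (halfspace (fst z) (snd z))" for n
  proof -
    have "open (U n)"
      unfolding U_def by (intro open_Collect_conj open_Collect_less continuous_intros)
    moreover have "(\<xi>, p + 1 / (2 * real (Suc n))) \<in> U n"
    proof -
      have "1 / (2 * real (Suc n)) < 1 / real (Suc n)"
        by (rule divide_strict_left_mono) auto
      then show ?thesis by (simp add: U_def del: of_nat_Suc)
    qed
    ultimately show ?thesis using open_meets_AE_lborel[OF ae] by blast
  qed
  then obtain z where zU: "\<And>n. z n \<in> U n"
    and z_eq: "\<And>n. snd (z n) > 0 \<Longrightarrow>
      emeasure M (halfspace (fst (z n)) (snd (z n))) = emeasure N (halfspace (fst (z n)) (snd (z n)))"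
    by metis
  have z: "p < snd (z n)" "snd (z n) - p < 1 / real (Suc n)"
      "norm (fst (z n) - \<xi>) * real (Suc n) < snd (z n) - p" for n
    using zU[of n] by (auto simp: U_def)
  have "(\<lambda>n. snd (z n) - p) \<longlonglongrightarrow> 0"
  proof (rule Lim_null_comparison)
    show "eventually (\<lambda>n. norm (snd (z n) - p) \<le> 1 / real (Suc n)) sequentially"
      using z(1,2) by (intro always_eventually allI) (simp add: less_imp_le)
    show "(\<lambda>n. 1 / real (Suc n)) \<longlonglongrightarrow> 0"
      using LIMSEQ_inverse_real_of_nat by (simp add: inverse_eq_divide)
  qed
  then have lim: "(\<lambda>n. snd (z n)) \<longlonglongrightarrow> p" by (simp add: LIM_zero_cancel)
  have lt1: "snd (z n) - p < 1" for n
    by (rule less_le_trans[OF z(2)[of n]]) simp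
  have "measure M (halfspace (fst (z n)) (snd (z n))) = measure N (halfspace (fst (z n)) (snd (z n)))" for n
    using z_eq[of n] z(1)[of n] \<open>p > 0\<close> by (simp add: measure_def)
  with halfspace_seq_lim[OF M \<open>p > 0\<close> z(1) lim z(3) lt1] halfspace_seq_lim[OF N \<open>p > 0\<close> z(1) lim z(3) lt1]
  show ?thesis by (metis (no_types, lifting) LIMSEQ_unique ext)
qed

section \<open>Integrals of ridge functions\<close>

text \<open>The image under \<open>\<xi> \<bullet> x\<close> may have infinite mass near 0. The
  logarithm moves 0 to minus infinity, so that all upper rays have finite mass and determine the
  image measure; offsets become \<open>exp a\<close>.\<close>

lemma ridge_integral_halfspace_eq:
  fixes \<xi> :: "'a::euclidean_space" and g :: "real \<Rightarrow> complex"
  assumes sets: "sets M = sets borel" "sets N = sets borel"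
    and fin: "\<And>p. p > 0 \<Longrightarrow> emeasure M (halfspace \<xi> p) < \<infinity>"
    and eq: "\<And>p. p > 0 \<Longrightarrow> emeasure M (halfspace \<xi> p) = emeasure N (halfspace \<xi> p)"
    and g [measurable]: "g \<in> borel_measurable borel"
  shows "(LINT x|M. indicator (halfspace \<xi> 0) x *\<^sub>R g (\<xi> \<bullet> x)) =
    (LINT x|N. indicator (halfspace \<xi> 0) x *\<^sub>R g (\<xi> \<bullet> x))"
proof -
  define push where "push K = distr (density K (\<lambda>x. ennreal (indicator (halfspace \<xi> 0) x))) borel (\<lambda>x. ln (\<xi> \<bullet> x))"
    for K :: "'a measure"
  have push_greater: "emeasure (push K) {a<..} = emeasure K (halfspace \<xi> (exp a))"
    if [measurable_cong]: "sets K = sets borel" for K a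
  proof -
    have sp: "space K = UNIV" using sets_eq_imp_space_eq[OF that] by simp
    have "halfspace \<xi> 0 \<inter> (\<lambda>x. ln (\<xi> \<bullet> x)) -` {a<..} = halfspace \<xi> (exp a)"
    proof -
      have "a < ln t \<longleftrightarrow> exp a < t" if "t > 0" for t :: real
        using that by (metis exp_less_cancel_iff exp_ln)
      then show ?thesis by (auto simp: halfspace_def intro: less_trans[OF exp_gt_zero])
    qed
    moreover have "(\<lambda>x. ln (\<xi> \<bullet> x)) -` {a<..} \<in> sets K"
      using measurable_sets[of "\<lambda>x. ln (\<xi> \<bullet> x)" K borel "{a<..}"] sp by simp
    ultimately show ?thesis
      by (simp add: push_def emeasure_distr sp emeasure_density nn_integral_indicator
        ennreal_indicator indicator_inter_arith[symmetric] that)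
  qed
  have "push M = push N"
  proof (rule measure_eqI_lessThan)
    show "emeasure (push M) {a<..} < \<infinity>" for a
      unfolding push_greater[OF sets(1)] by (rule fin) simp
    show "emeasure (push M) {a<..} = emeasure (push N) {a<..}" for a
      unfolding push_greater[OF sets(1)] push_greater[OF sets(2)] by (rule eq) simp
  qed (simp_all add: push_def)
  moreover have "(LINT x|K. indicator (halfspace \<xi> 0) x *\<^sub>R g (\<xi> \<bullet> x)) = (LINT s|push K. g (exp s))"
    if [measurable_cong]: "sets K = sets borel" for K
  proof -
    have "(LINT s|push K. g (exp s)) = (LINT x|K. indicator (halfspace \<xi> 0) x *\<^sub>R g (exp (ln (\<xi> \<bullet> x))))"
      unfolding push_def by (subst integral_distr, simp, simp, subst integral_density) auto
    also have "\<dots> = (LINT x|K. indicator (halfspace \<xi> 0) x *\<^sub>R g (\<xi> \<bullet> x))"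
      by (intro Bochner_Integration.integral_cong) (auto simp: halfspace_def indicator_def)
    finally show ?thesis by simp
  qed
  ultimately show ?thesis using sets by simp
qed

text \<open>Split by the sign of \<open>\<xi> \<bullet> x\<close>: the negative side is the positive
  side for \<open>- \<xi>\<close> with \<open>g\<close> reflected, and \<open>g 0 = 0\<close>
  removes the hyperplane through the origin.\<close>

lemma ridge_integral_eq:
  fixes \<xi> :: "'a::euclidean_space" and g :: "real \<Rightarrow> complex"
  assumes M: "sets M = sets borel" "\<And>r. r > 0 \<Longrightarrow> emeasure M {x. r \<le> norm x} < \<infinity>"
    and N: "sets N = sets borel" "\<And>r. r > 0 \<Longrightarrow> emeasure N {x. r \<le> norm x} < \<infinity>"
    and eq: "\<And>\<xi> p. p > 0 \<Longrightarrow> measure M (halfspace \<xi> p) = measure N (halfspace \<xi> p)"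
    and g: "g \<in> borel_measurable borel" "g 0 = 0"
    and int: "integrable M (\<lambda>x. g (\<xi> \<bullet> x))" "integrable N (\<lambda>x. g (\<xi> \<bullet> x))"
  shows "(LINT x|M. g (\<xi> \<bullet> x)) = (LINT x|N. g (\<xi> \<bullet> x))"
proof -
  have fin: "emeasure K (halfspace \<eta> p) < \<infinity>"
    if K: "sets K = sets borel" "\<And>r. r > 0 \<Longrightarrow> emeasure K {x. r \<le> norm x} < \<infinity>" and "p > 0"
    for K :: "'a measure" and \<eta> p
  proof -
    have "p / (norm \<eta> + 1) \<le> norm x" if "x \<in> halfspace \<eta> p" for x
    proof -
      have "p < norm \<eta> * norm x"
        using that norm_cauchy_schwarz[of \<eta> x] by (simp add: halfspace_def)
      also have "\<dots> \<le> norm x * (norm \<eta> + 1)" by (simp add: algebra_simps)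
      finally show ?thesis by (simp add: divide_le_eq add_nonneg_pos)
    qed
    then have "emeasure K (halfspace \<eta> p) \<le> emeasure K {x. p / (norm \<eta> + 1) \<le> norm x}"
      using K(1) by (intro emeasure_mono) auto
    also have "\<dots> < \<infinity>" using \<open>p > 0\<close> by (intro K(2) divide_pos_pos) (auto simp: add_nonneg_pos)
    finally show ?thesis .
  qed
  \<comment> \<open>Finiteness rules out the default value 0 of \<open>measure\<close> on sets of
    infinite mass, so the equality lifts to \<open>emeasure\<close>.\<close>
  have eq': "emeasure M (halfspace \<eta> p) = emeasure N (halfspace \<eta> p)" if "p > 0" for \<eta> p
    using fin[OF M that, of \<eta>] fin[OF N that, of \<eta>] eq[OF that, of \<eta>]
    by (metis emeasure_eq_ennreal_measure infinity_ennreal_def less_irrefl)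
  have split: "(LINT x|K. g (\<xi> \<bullet> x)) = (LINT x|K. indicator (halfspace \<xi> 0) x *\<^sub>R g (\<xi> \<bullet> x)) +
      (LINT x|K. indicator (halfspace (- \<xi>) 0) x *\<^sub>R g (- (- \<xi> \<bullet> x)))"
    if K: "sets K = sets borel" "integrable K (\<lambda>x. g (\<xi> \<bullet> x))" for K
  proof -
    have "(LINT x|K. g (\<xi> \<bullet> x)) = (LINT x|K. indicator (halfspace \<xi> 0) x *\<^sub>R g (\<xi> \<bullet> x) +
        indicator (halfspace (- \<xi>) 0) x *\<^sub>R g (- (- \<xi> \<bullet> x)))"
      using g(2) by (intro Bochner_Integration.integral_cong)
        (auto simp: halfspace_def indicator_def not_less intro: antisym dest: antisym)
    also have "\<dots> = (LINT x|K. indicator (halfspace \<xi> 0) x *\<^sub>R g (\<xi> \<bullet> x)) +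
      (LINT x|K. indicator (halfspace (- \<xi>) 0) x *\<^sub>R g (- (- \<xi> \<bullet> x)))"
      using K by (intro Bochner_Integration.integral_add integrable_mult_indicator) auto
    finally show ?thesis .
  qed
  have "(\<lambda>t. g (- t)) \<in> borel_measurable borel" using g(1) by measurable
  note neg = ridge_integral_halfspace_eq[OF M(1) N(1) fin[OF M] eq' this, of "- \<xi>"]
  show ?thesis
    unfolding split[OF M(1) int(1)] split[OF N(1) int(2)]
    using ridge_integral_halfspace_eq[OF M(1) N(1) fin[OF M] eq' g(1), of \<xi>] neg by simp
qed

section \<open>From ridge integrals to Fourier transforms of weighted measures\<close>

text \<open>For fixed \<open>x\<close>, a difference in the argument with step
  \<open>h \<bullet> x\<close> is a difference in the frequency with step \<open>h\<close>. Hence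
  each stage is a linear combination of the previous one at \<open>\<xi>\<close> and
  \<open>\<xi> \<plusminus> h\<close>.\<close>

lemma central_diff_pow_integral_eq:
  fixes f :: "real \<Rightarrow> complex" and \<xi> :: "'a::euclidean_space"
  assumes f: "\<And>\<eta>. integrable M (\<lambda>x. f (\<eta> \<bullet> x))" "\<And>\<eta>. integrable N (\<lambda>x. f (\<eta> \<bullet> x))"
    "\<And>\<eta>. (LINT x|M. f (\<eta> \<bullet> x)) = (LINT x|N. f (\<eta> \<bullet> x))"
  shows "integrable M (\<lambda>x. (central_diff (h \<bullet> x) ^^ k) f (\<xi> \<bullet> x)) \<and>
    integrable N (\<lambda>x. (central_diff (h \<bullet> x) ^^ k) f (\<xi> \<bullet> x)) \<and>
    (LINT x|M. (central_diff (h \<bullet> x) ^^ k) f (\<xi> \<bullet> x)) = (LINT x|N. (central_diff (h \<bullet> x) ^^ k) f (\<xi> \<bullet> x))"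
proof (induction k arbitrary: \<xi>)
  case (Suc k)
  have "(central_diff (h \<bullet> x) ^^ Suc k) f (\<xi> \<bullet> x) = (central_diff (h \<bullet> x) ^^ k) f (\<xi> \<bullet> x) -
    ((central_diff (h \<bullet> x) ^^ k) f ((\<xi> + h) \<bullet> x) + (central_diff (h \<bullet> x) ^^ k) f ((\<xi> - h) \<bullet> x)) / 2" for x
    by (simp add: central_diff_def inner_add_left inner_diff_left)
  then show ?case
    using Suc.IH[of \<xi>] Suc.IH[of "\<xi> + h"] Suc.IH[of "\<xi> - h"] by simp
qed (use f in simp)

text \<open>Markov's inequality: outside the ball of radius \<open>r\<close> the integrable function
  is bounded below by its positive value \<open>c\<close> at radius \<open>r\<close>.\<close>

lemma emeasure_norm_ge_finite:
  fixes M :: "'a::euclidean_space measure"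
  assumes "integrable M (\<lambda>x. min (norm x ^ m) (norm x ^ Suc m))" and "sets M = sets borel" and "r > 0"
  shows "emeasure M {x. r \<le> norm x} < \<infinity>"
proof -
  define c where "c = min (r ^ m) (r ^ Suc m)"
  have "c > 0" using \<open>r > 0\<close> by (simp add: c_def)
  have sp: "space M = UNIV" using sets_eq_imp_space_eq[OF assms(2)] by simp
  have "emeasure M {x. r \<le> norm x} \<le> emeasure M {x \<in> space M. c \<le> min (norm x ^ m) (norm x ^ Suc m)}"
  proof (rule emeasure_mono)
    have "c \<le> min (norm x ^ m) (norm x ^ Suc m)" if "r \<le> norm x" for x :: 'a
    proof -
      have "r ^ n \<le> norm x ^ n" for n using that \<open>r > 0\<close> by (intro power_mono) auto
      then show ?thesis unfolding c_def by (meson min.mono)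
    qed
    then show "{x. r \<le> norm x} \<subseteq> {x \<in> space M. c \<le> min (norm x ^ m) (norm x ^ Suc m)}"
      by (auto simp: sp)
    have "(\<lambda>x. min (norm x ^ m) (norm x ^ Suc m)) \<in> borel_measurable M"
      using assms(1) by (rule borel_measurable_integrable)
    then show "{x \<in> space M. c \<le> min (norm x ^ m) (norm x ^ Suc m)} \<in> sets M" by measurable
  qed
  also have "\<dots> \<le> ennreal (1 / c * (LINT x|M. min (norm x ^ m) (norm x ^ Suc m)))"
    by (rule integral_Markov_inequality[OF assms(1) _ \<open>c > 0\<close>]) (auto intro!: AE_I2)
  also have "\<dots> < \<infinity>" by simp
  finally show ?thesis .
qed

lemma integrable_iexp_rem:
  fixes M :: "'a::euclidean_space measure"
  assumes "integrable M (\<lambda>x. min (norm x ^ m) (norm x ^ Suc m))" and sets: "sets M = sets borel"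
  shows "integrable M (\<lambda>x. iexp_rem m (\<xi> \<bullet> x))"
proof (rule Bochner_Integration.integrable_bound)
  show "integrable M (\<lambda>x. (2 * norm \<xi> ^ m + norm \<xi> ^ Suc m) * min (norm x ^ m) (norm x ^ Suc m))"
    using assms(1) by (rule integrable_mult_right)
  show "(\<lambda>x. iexp_rem m (\<xi> \<bullet> x)) \<in> borel_measurable M"
    unfolding iexp_rem_def using sets by (subst measurable_cong_sets[OF sets refl]) measurable
  have "norm (iexp_rem m (\<xi> \<bullet> x)) \<le> (2 * norm \<xi> ^ m + norm \<xi> ^ Suc m) * min (norm x ^ m) (norm x ^ Suc m)" for x
    by (rule norm_iexp_rem_le) (auto simp: Cauchy_Schwarz_ineq2)
  then show "AE x in M. norm (iexp_rem m (\<xi> \<bullet> x)) \<le>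
      norm ((2 * norm \<xi> ^ m + norm \<xi> ^ Suc m) * min (norm x ^ m) (norm x ^ Suc m))"
    by (intro AE_I2) (metis abs_ge_self order_trans real_norm_def)
qed

text \<open>The \<open>Suc m\<close>-fold difference of the remainder integrals with step
  \<open>h\<close> is the Fourier transform of the weighted measure, so both transforms agree at
  every frequency.\<close>

lemma density_cos_eq:
  fixes M N :: "'a::euclidean_space measure"
  assumes sets: "sets M = sets borel" "sets N = sets borel"
    and int: "integrable M (\<lambda>x. min (norm x ^ m) (norm x ^ Suc m))"
      "integrable N (\<lambda>x. min (norm x ^ m) (norm x ^ Suc m))"
    and eq: "\<And>\<xi> p. p > 0 \<Longrightarrow> measure M (halfspace \<xi> p) = measure N (halfspace \<xi> p)"
  shows "density M (\<lambda>x. ennreal ((1 - cos (h \<bullet> x)) ^ Suc m)) = density N (\<lambda>x. ennreal ((1 - cos (h \<bullet> x)) ^ Suc m))"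
proof -
  note [measurable_cong] = sets
  define w :: "'a \<Rightarrow> real" where "w x = (1 - cos (h \<bullet> x)) ^ Suc m" for x
  have w_nonneg: "0 \<le> w x" for x by (simp add: w_def del: power_Suc)
  have w_meas [measurable]: "w \<in> borel_measurable borel" unfolding w_def by measurable
  have rem_meas: "iexp_rem m \<in> borel_measurable borel"
    unfolding iexp_rem_def by measurable
  have "(LINT x|M. iexp_rem m (\<eta> \<bullet> x)) = (LINT x|N. iexp_rem m (\<eta> \<bullet> x))" for \<eta>
    by (rule ridge_integral_eq[OF sets(1) emeasure_norm_ge_finite[OF int(1) sets(1)] sets(2)
          emeasure_norm_ge_finite[OF int(2) sets(2)] eq rem_meas iexp_rem_0
          integrable_iexp_rem[OF int(1) sets(1)] integrable_iexp_rem[OF int(2) sets(2)]])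
  from central_diff_pow_integral_eq[OF integrable_iexp_rem[OF int(1) sets(1)]
      integrable_iexp_rem[OF int(2) sets(2)] this, where h=h and k="Suc m"]
  have *: "integrable M (\<lambda>x. w x *\<^sub>R iexp (\<xi> \<bullet> x)) \<and> integrable N (\<lambda>x. w x *\<^sub>R iexp (\<xi> \<bullet> x)) \<and>
      (LINT x|M. w x *\<^sub>R iexp (\<xi> \<bullet> x)) = (LINT x|N. w x *\<^sub>R iexp (\<xi> \<bullet> x))" for \<xi>
    unfolding central_diff_pow_iexp_rem[OF lessI] w_def scaleR_conv_of_real by blast
  \<comment> \<open>Finiteness is the integrability above at frequency 0, where the exponential is
    1.\<close>
  have fin: "finite_measure (density K (\<lambda>x. ennreal (w x)))"
    if K: "integrable K (\<lambda>x. w x *\<^sub>R iexp (0 \<bullet> x))" "sets K = sets borel" for K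
  proof
    have "integrable K (\<lambda>x. norm (w x *\<^sub>R iexp (0 \<bullet> x)))" using K(1) by (rule integrable_norm)
    then have "integrable K w" using w_nonneg by simp
    then have "(\<integral>\<^sup>+x. ennreal (w x) \<partial>K) < \<infinity>"
      using w_nonneg by (simp add: integrable_iff_bounded)
    moreover have "emeasure (density K (\<lambda>x. ennreal (w x))) (space K) = (\<integral>\<^sup>+x. ennreal (w x) \<partial>K)"
      using that(2) by (subst emeasure_density) (auto intro!: nn_integral_cong)
    ultimately show "emeasure (density K (\<lambda>x. ennreal (w x))) (space (density K (\<lambda>x. ennreal (w x)))) \<noteq> \<infinity>"
      by simp
  qed
  have "density M (\<lambda>x. ennreal (w x)) = density N (\<lambda>x. ennreal (w x))"
  proof (rule finite_measure_eqI_char)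
    show "finite_measure (density M (\<lambda>x. ennreal (w x)))" "finite_measure (density N (\<lambda>x. ennreal (w x)))"
      using fin *[of 0] sets by blast+
    show "(LINT x|density M (\<lambda>x. ennreal (w x)). iexp (\<xi> \<bullet> x)) =
      (LINT x|density N (\<lambda>x. ennreal (w x)). iexp (\<xi> \<bullet> x))" for \<xi>
      using *[of \<xi>] w_nonneg by (simp add: integral_density)
  qed (simp_all add: sets)
  then show ?thesis by (simp only: w_def)
qed

section \<open>Vanishing of both parts by singularity\<close>

text \<open>The weighted \<open>M\<close> vanishes on \<open>S\<close>, hence so does the weighted
  \<open>N\<close>; as \<open>N\<close> is carried by \<open>S\<close>, its weight is null.\<close>

lemma AE_zero_if_density_eq_singular:
  fixes w :: "'a \<Rightarrow> real"
  assumes "density M (\<lambda>x. ennreal (w x)) = density N (\<lambda>x. ennreal (w x))"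
    and sets: "sets M = sets N" and w [measurable]: "w \<in> borel_measurable M" "w \<in> borel_measurable N" "\<And>x. 0 \<le> w x"
    and S: "S \<in> sets M" "emeasure M S = 0" "AE x in N. x \<in> S"
  shows "AE x in N. w x = 0"
proof -
  have "emeasure (density M (\<lambda>x. ennreal (w x))) S = 0"
  proof -
    have "AE x in M. x \<notin> S"
      using S by (intro AE_not_in) (auto simp: null_sets_def)
    then have "AE x in M. ennreal (w x) * indicator S x = 0"
      by eventually_elim simp
    then show ?thesis using S by (simp add: emeasure_density nn_integral_0_iff_AE)
  qed
  then have "(\<integral>\<^sup>+x. ennreal (w x) * indicator S x \<partial>N) = 0"
    unfolding assms(1) using S sets by (subst (asm) emeasure_density) auto
  then have "AE x in N. ennreal (w x) * indicator S x = 0"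
    using S(1) sets by (subst (asm) nn_integral_0_iff_AE) auto
  with S(3) show ?thesis
    by eventually_elim (use w(3) in \<open>auto simp: ennreal_eq_0_iff intro: antisym\<close>)
qed

text \<open>Dividing a nonzero coordinate by a large integer gives an angle of size strictly between
  0 and 1. Countably many vectors therefore detect every nonzero point.\<close>

lemma cos_scaled_neq_1:
  fixes x :: "'a::euclidean_space"
  assumes "x \<noteq> 0"
  obtains b and n :: nat where "b \<in> Basis" and "cos (((1 / real n) *\<^sub>R b) \<bullet> x) \<noteq> 1"
proof -
  obtain b where b: "b \<in> Basis" "b \<bullet> x \<noteq> 0"
    using assms euclidean_eq_iff[of x 0] by (auto simp: inner_commute)
  obtain n :: nat where n: "\<bar>b \<bullet> x\<bar> < n" using reals_Archimedean2 by blast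
  define t where "t = \<bar>b \<bullet> x\<bar> / n"
  have "0 < t" "t < 1" using n b(2) by (auto simp: t_def field_simps)
  then have "cos t < cos 0" using pi_gt3 by (intro cos_monotone_0_pi) auto
  moreover have "cos (((1 / real n) *\<^sub>R b) \<bullet> x) = cos t"
    using cos_abs_real[of "(b \<bullet> x) / n"] by (simp add: t_def abs_divide)
  ultimately show thesis using that[OF b(1), of n] by simp
qed

lemma emeasure_0_if_AE_cos_eq_1:
  fixes M :: "'a::euclidean_space measure"
  assumes M: "loc_finite_away0 M" and cos: "\<And>h. AE x in M. cos (h \<bullet> x) = 1"
  shows "emeasure M A = 0"
proof -
  \<comment> \<open>A countable family of vectors keeps the exceptional set null. With
    \<open>1 / 0 = 0\<close>, the index \<open>n = 0\<close> is the trivial case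
    \<open>cos 0 = 1\<close>.\<close>
  have "AE x in M. \<forall>b\<in>Basis. \<forall>n::nat. cos (((1 / real n) *\<^sub>R b) \<bullet> x) = 1"
    by (intro AE_finite_allI finite_Basis) (simp only: AE_all_countable cos, simp)
  moreover have "AE x in M. x \<noteq> 0"
    using M by (intro AE_I[of _ _ "{0}"]) (auto simp: loc_finite_away0_def)
  ultimately have "AE x in M. False"
    by eventually_elim (metis cos_scaled_neq_1)
  then have "emeasure M (space M) = 0"
    by (simp add: AE_iff_measurable[of "space M"] )
  then show ?thesis
    using emeasure_space[of M A] by simp
qed

theorem mainTheorem8:
  fixes M N :: "'a::euclidean_space measure" and \<alpha> :: real
  assumes "loc_finite_away0 M" and "loc_finite_away0 N"
    and "mutually_singular M N"
    and "homogeneous_signed M N \<alpha>"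
    and "\<alpha> < - real DIM('a)" and "\<alpha> \<notin> \<int>"
    and "AE z in (lborel :: ('a \<times> real) measure).
           snd z > 0 \<longrightarrow> emeasure M (halfspace (fst z) (snd z)) = emeasure N (halfspace (fst z) (snd z))"
  shows "\<forall>A\<in>sets borel. emeasure M A = 0 \<and> emeasure N A = 0"
proof -
  have sets: "sets M = sets borel" "sets N = sets borel"
    using assms(1,2) by (auto simp: loc_finite_away0_def)
  have sp: "space M = UNIV" "space N = UNIV"
    using sets by (metis sets_eq_imp_space_eq space_borel)+
  define \<beta> where "\<beta> = - (\<alpha> + real DIM('a))"
  \<comment> \<open>The integer part of \<open>\<beta>\<close>; non-integrality makes both of the
    following bounds strict.\<close>
  define m where "m = nat \<lfloor>\<beta>\<rfloor>"
  have "\<beta> > 0" using assms(5) by (simp add: \<beta>_def)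
  have "\<beta> \<notin> \<int>"
  proof
    assume "\<beta> \<in> \<int>"
    then have "- \<beta> - real DIM('a) \<in> \<int>" by (intro Ints_diff Ints_minus Ints_of_nat)
    then show False using assms(6) by (simp add: \<beta>_def)
  qed
  then have m: "real m < \<beta>" "\<beta> < real (Suc m)"
  proof -
    have "real m = of_int \<lfloor>\<beta>\<rfloor>" using \<open>\<beta> > 0\<close> by (simp add: m_def)
    moreover have "of_int \<lfloor>\<beta>\<rfloor> \<noteq> \<beta>" using \<open>\<beta> \<notin> \<int>\<close> by (metis Ints_of_int)
    ultimately show "real m < \<beta>" "\<beta> < real (Suc m)" by linarith+
  qed
  have sing': "mutually_singular N M"
    by (rule mutually_singular_sym[OF assms(3)]) (simp add: sets)
  have exponent: "\<alpha> + real DIM('a) = - \<beta>" by (simp add: \<beta>_def)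
  \<comment> \<open>Both parts obey the scaling bound, the negative one after exchanging the roles
    of \<open>M\<close> and \<open>N\<close>.\<close>
  note int = integrable_min_norm_power[OF assms(1)
      homogeneous_positive_part_le[OF assms(1,2,3,4), unfolded exponent] m]
    integrable_min_norm_power[OF assms(2)
      homogeneous_positive_part_le[OF assms(2,1) sing' homogeneous_signed_swap[OF assms(4)], unfolded exponent] m]
  have halfspace_eq: "measure M (halfspace \<xi> p) = measure N (halfspace \<xi> p)" if "p > 0" for \<xi> p
    by (rule measure_halfspace_eq[OF sets(1) emeasure_norm_ge_finite[OF int(1) sets(1)] sets(2)
          emeasure_norm_ge_finite[OF int(2) sets(2)] assms(7) that])
  note dens = density_cos_eq[OF sets int halfspace_eq]
  obtain S where S: "S \<in> sets borel" "emeasure M S = 0" "emeasure N (- S) = 0"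
    using assms(3) unfolding mutually_singular_def sp sets Compl_eq_Diff_UNIV by blast
  have w: "(\<lambda>x. (1 - cos (h \<bullet> x)) ^ Suc m) \<in> borel_measurable M"
    "(\<lambda>x. (1 - cos (h \<bullet> x)) ^ Suc m) \<in> borel_measurable N"
    "0 \<le> (1 - cos (h \<bullet> x)) ^ Suc m" for h x
    by (simp_all add: measurable_cong_sets[OF sets(1) refl] measurable_cong_sets[OF sets(2) refl] del: power_Suc)
  have "AE x in N. (1 - cos (h \<bullet> x)) ^ Suc m = 0" for h
  proof (rule AE_zero_if_density_eq_singular[OF dens _ w])
    show "AE x in N. x \<in> S"
      using S sets by (intro AE_I[of _ _ "- S"]) auto
  qed (use S sets in auto)
  then have "AE x in N. cos (h \<bullet> x) = 1" for h by (simp del: power_Suc)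
  note N = emeasure_0_if_AE_cos_eq_1[OF assms(2) this]
  \<comment> \<open>The complement of \<open>S\<close> is null for \<open>N\<close> and carries
    \<open>M\<close>, so the same argument applies with the measures exchanged.\<close>
  have "AE x in M. (1 - cos (h \<bullet> x)) ^ Suc m = 0" for h
  proof (rule AE_zero_if_density_eq_singular[OF dens[symmetric] _ w(2,1,3)])
    show "AE x in M. x \<in> - S"
      using S sets by (intro AE_I[of _ _ S]) auto
  qed (use S sets in auto)
  then have "AE x in M. cos (h \<bullet> x) = 1" for h by (simp del: power_Suc)
  note M = emeasure_0_if_AE_cos_eq_1[OF assms(1) this]
  show ?thesis using M N by blast
qed

end
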